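(* Consider the infinitely repeated game described in the context, let $a\in\mathcal N$ be a player and let $n\ge1$. Let $\hat T_a^{(1)}$ be the Press–Dyson vectors of a memory-one zero-determinant (ZD) strategy of player $a$: $$\sum_{\sigma_a}c_{\sigma_a}\hat T_a^{(1)}\left(\sigma_a|\bm\sigma^{(-1)}\right)=\sum_{b=0}^N\alpha_b s_b\left(\bm\sigma^{(-1)}\right)\qquad\left(\forall\bm\sigma^{(-1)}\in\mathcal A\right)$$ with some coefficients $\{c_{\sigma_a}\}$ and $\{\alpha_b\}$. Let $K:\mathcal A^n\to\mathbb R\cup\{-\infty\}$ be a function (so $K(\cdot)<\infty$) that is not identically $-\infty$, and define $$K_{\max}=\max_{\bm\sigma^{(-1)},\dots,\bm\sigma^{(-n)}}K\left(\bm\sigma^{(-1)},\dots,\bm\sigma^{(-n)}\right).$$ Then a memory-$n$ strategy of player $a$ whose Press–Dyson tensor is $$\hat T_a\left(\sigma_a|\bm\sigma^{(-1)},\dots,\bm\sigma^{(-n)}\right)=\hat T_a^{(1)}\left(\sigma_a|\bm\sigma^{(-1)}\right)e^{K\left(\bm\sigma^{(-1)},\dots,\bm\sigma^{(-n)}\right)-K_{\max}}\qquad\left(\forall\sigma_a\in A_a,\ \forall\bm\sigma^{(-1)},\dots,\bm\sigma^{(-n)}\in\mathcal A\right)$$ unilaterally enforces either a linear relation between expected payoffs in the ensemble biased by $K$, $$0=\sum_{b=0}^N\alpha_b\frac{\left\langle s_b\left(\bm\sigma^{(-1)}\right)e^{K\left(\bm\sigma^{(-1)},\dots,\bm\sigma^{(-n)}\right)}\right\rangle^*}{\left\langle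 e^{K\left(\bm\sigma^{(-1)},\dots,\bm\sigma^{(-n)}\right)}\right\rangle^*}$$ (with nonzero denominator), or the relation $$0=P^*\left(\bm\sigma^{(-1)},\dots,\bm\sigma^{(-n)}\right)\qquad\left(\forall\left(\bm\sigma^{(-1)},\dots,\bm\sigma^{(-n)}\right)\in\operatorname{supp}e^{K(\cdot)}\right).$$
   Context: Game: the set of players is $\mathcal N=\{1,\dots,N\}$; player $a$ has the finite action set $A_a=\{1,\dots,M_a\}$; $\mathcal A=\prod_{a=1}^N A_a$ is the set of action profiles $\bm\sigma=(\sigma_1,\dots,\sigma_N)$; $s_b(\bm\sigma)\in\mathbb R$ is the one-shot payoff of player $b\in\mathcal N$, and $s_0(\bm\sigma):=1$ for all $\bm\sigma$. The game is repeated infinitely often; $\bm\sigma(t)$ is the action profile in round $t\ge 1$. A (behavior) strategy of player $a$ is a sequence $\{T_a^{(t)}\}_{t\ge1}$, where $T_a^{(t)}$ maps each history in $\mathcal A^{t-1}$ to a probability distribution on $A_a$. Given strategies of all players, the joint distribution of the first $t$ profiles is $$\mathbb P_t(\bm\sigma(t),\dots,\bm\sigma(1))=\prod_{t'=1}^t\prod_{b=1}^N T_b^{(t')}(\sigma_b(t')|\bm\sigma(t'-1),\dots,\bm\sigma(1)).$$ Memory-$n$ strategy: a strategy of player $a$ is a (time-independent) memory-$n$ strategy if there is a single conditional probability $T_a(\sigma_a|\bm\sigma^{(-1)},\dots,\bm\sigma^{(-n)})$ such that $T_a^{(t)}(\sigma_a(t)|\bm\sigma(t-1),\dots,\bm\sigma(1))=T_a(\sigma_a(t)|\bm\sigma(t-1),\dots,\bm\sigma(t-n))$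 for all $t>n$, all $\sigma_a(t)$ and all histories. Its Press–Dyson tensor is $\hat T_a(\sigma_a|\bm\sigma^{(-1)},\dots,\bm\sigma^{(-n)})=T_a(\sigma_a|\bm\sigma^{(-1)},\dots,\bm\sigma^{(-n)})-\delta_{\sigma_a,\sigma_a^{(-1)}}$ ($\delta$ the Kronecker delta); for $n=1$ it is called the Press–Dyson vectors. Memory-one ZD strategy of player $a$: a memory-one strategy whose Press–Dyson vectors satisfy $\sum_{\sigma_a}c_{\sigma_a}\hat T_a(\sigma_a|\bm\sigma^{(-1)})=\sum_{b=0}^N\alpha_b s_b(\bm\sigma^{(-1)})$ for all $\bm\sigma^{(-1)}$, with nontrivial real coefficients (not $c_1=\dots=c_{M_a}$, and not $\alpha_0=\dots=\alpha_N=0$). Limit distribution: for $t\ge n$ let $P_t(\bm\sigma(t),\dots,\bm\sigma(t-n+1))$ be the marginal of $\mathbb P_t$ on the last $n$ profiles, and $$P^*(\bm\sigma^{(-1)},\dots,\bm\sigma^{(-n)})=\lim_{T\to\infty}\frac1T\sum_{t=n}^{T+n-1}P_t(\bm\sigma^{(-1)},\dots,\bm\sigma^{(-n)}),$$ where $\bm\sigma^{(-1)}$ is the most recent profile. It is assumed throughout that $P^*$ exists. $\langle\cdots\rangle^*$ denotes expectation with respect to $P^*(\bm\sigma^{(-1)},\dots,\bm\sigma^{(-n)})$. "Unilaterally enforces" means that, when player $a$ uses the stated strategy, the conclusion holds whatever the strategies of all other players are (these are arbitrary behavior strategies); which of two alternatives holds may depend on those strategies. Conventions: $e^{-\infty}=0$;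 $\operatorname{supp}f$ is the set of points where $f\neq0$. *)

theory Defs
  imports "HOL-Probability.Probability"
begin

type_synonym profile = "nat \<Rightarrow> nat"

text \<open>A word of profiles lists the most recent profile first, both for the history of a game and
  for the profiles of its last \<open>n\<close> rounds. The round played after the history \<open>h\<close> is
  \<open>length h + 1\<close>, so one function on histories represents a whole sequence of maps, one for each
  round, that makes up a behavior strategy.\<close>

type_synonym history = "profile list"
type_synonym behavior = "history \<Rightarrow> nat pmf"

definition players :: "nat \<Rightarrow> nat set" where
  "players N = {1..N}"

definition actions :: "(nat \<Rightarrow> nat) \<Rightarrow> nat \<Rightarrow> nat set" where
  "actions M a = {1..M a}"

definition profiles :: "nat \<Rightarrow> (nat \<Rightarrow> nat) \<Rightarrow> profile set" where
  "profiles N M = (\<Pi>\<^sub>E a\<in>players N. actions M a)"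

definition words :: "nat \<Rightarrow> (nat \<Rightarrow> nat) \<Rightarrow> nat \<Rightarrow> history set" where
  "words N M n = {w. set w \<subseteq> profiles N M \<and> length w = n}"

definition payoff :: "(nat \<Rightarrow> profile \<Rightarrow> real) \<Rightarrow> nat \<Rightarrow> profile \<Rightarrow> real" where
  "payoff s b \<sigma> = (if b = 0 then 1 else s b \<sigma>)"

definition strategy :: "nat \<Rightarrow> (nat \<Rightarrow> nat) \<Rightarrow> nat \<Rightarrow> behavior \<Rightarrow> bool" where
  "strategy N M a S \<longleftrightarrow> (\<forall>t. \<forall>h\<in>words N M t. set_pmf (S h) \<subseteq> actions M a)"

text \<open>\<open>S\<close> is a memory-\<open>n\<close> strategy with conditional probability \<open>T\<close>; it may play arbitrarily in
  the rounds \<open>1, \<dots>, n\<close>.\<close>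

definition memory_strategy ::
    "nat \<Rightarrow> (nat \<Rightarrow> nat) \<Rightarrow> nat \<Rightarrow> nat \<Rightarrow> behavior \<Rightarrow> (history \<Rightarrow> nat pmf) \<Rightarrow> bool" where
  "memory_strategy N M a n S T \<longleftrightarrow>
     strategy N M a S \<and>
     (\<forall>w\<in>words N M n. set_pmf (T w) \<subseteq> actions M a) \<and>
     (\<forall>t>n. \<forall>h\<in>words N M (t - 1). S h = T (take n h))"

definition press_dyson :: "nat \<Rightarrow> (history \<Rightarrow> nat pmf) \<Rightarrow> nat \<Rightarrow> history \<Rightarrow> real" where
  "press_dyson a T x w = pmf (T w) x - (if x = hd w a then 1 else 0)"

definition memory_one_ZD_strategy ::
    "nat \<Rightarrow> (nat \<Rightarrow> nat) \<Rightarrow> (nat \<Rightarrow> profile \<Rightarrow> real) \<Rightarrow> nat \<Rightarrow> (nat \<Rightarrow> real) \<Rightarrow> (nat \<Rightarrow> real) \<Rightarrow>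
     behavior \<Rightarrow> (history \<Rightarrow> nat pmf) \<Rightarrow> bool" where
  "memory_one_ZD_strategy N M s a c \<alpha> S T \<longleftrightarrow>
     memory_strategy N M a 1 S T \<and>
     (\<forall>\<sigma>\<in>profiles N M.
        (\<Sum>x\<in>actions M a. c x * press_dyson a T x [\<sigma>]) = (\<Sum>b=0..N. \<alpha> b * payoff s b \<sigma>)) \<and>
     \<not> (\<forall>x\<in>actions M a. \<forall>y\<in>actions M a. c x = c y) \<and>
     \<not> (\<forall>b\<in>{0..N}. \<alpha> b = 0)"

text \<open>The joint distribution of the first \<open>t\<close> profiles: in a word of length \<open>t\<close>, the profile of
  round \<open>t'\<close> is \<open>h ! (t - t')\<close>, and the profiles before it form \<open>drop (t - t' + 1) h\<close>.\<close>

definition joint_prob :: "nat \<Rightarrow> (nat \<Rightarrow> behavior) \<Rightarrow> nat \<Rightarrow> history \<Rightarrow> real" where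
  "joint_prob N S t h =
     (\<Prod>t'=1..t. \<Prod>b\<in>players N. pmf (S b (drop (t - t' + 1) h)) ((h ! (t - t')) b))"

definition marginal_prob ::
    "nat \<Rightarrow> (nat \<Rightarrow> nat) \<Rightarrow> (nat \<Rightarrow> behavior) \<Rightarrow> nat \<Rightarrow> nat \<Rightarrow> history \<Rightarrow> real" where
  "marginal_prob N M S n t w = (\<Sum>u\<in>words N M (t - n). joint_prob N S t (w @ u))"

definition time_average ::
    "nat \<Rightarrow> (nat \<Rightarrow> nat) \<Rightarrow> (nat \<Rightarrow> behavior) \<Rightarrow> nat \<Rightarrow> history \<Rightarrow> nat \<Rightarrow> real" where
  "time_average N M S n w \<tau> = (1 / real \<tau>) * (\<Sum>t=n..\<tau> + n - 1. marginal_prob N M S n t w)"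

definition limit_distribution_exists ::
    "nat \<Rightarrow> (nat \<Rightarrow> nat) \<Rightarrow> (nat \<Rightarrow> behavior) \<Rightarrow> nat \<Rightarrow> bool" where
  "limit_distribution_exists N M S n \<longleftrightarrow> (\<forall>w\<in>words N M n. convergent (time_average N M S n w))"

definition limit_distribution ::
    "nat \<Rightarrow> (nat \<Rightarrow> nat) \<Rightarrow> (nat \<Rightarrow> behavior) \<Rightarrow> nat \<Rightarrow> history \<Rightarrow> real" where
  "limit_distribution N M S n w = lim (time_average N M S n w)"

definition expect ::
    "nat \<Rightarrow> (nat \<Rightarrow> nat) \<Rightarrow> nat \<Rightarrow> (history \<Rightarrow> real) \<Rightarrow> (history \<Rightarrow> real) \<Rightarrow> real" where
  "expect N M n P f = (\<Sum>w\<in>words N M n. f w * P w)"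

text \<open>The strategy \<open>S\<^sub>a\<close> of player \<open>a\<close> enforces the property \<open>C\<close> of the limit distribution whatever
  behavior strategies the other players use, provided that the limit distribution exists.\<close>

definition unilaterally_enforces ::
    "nat \<Rightarrow> (nat \<Rightarrow> nat) \<Rightarrow> nat \<Rightarrow> nat \<Rightarrow> behavior \<Rightarrow> ((history \<Rightarrow> real) \<Rightarrow> bool) \<Rightarrow> bool" where
  "unilaterally_enforces N M n a S\<^sub>a C \<longleftrightarrow>
     (\<forall>S. (\<forall>b\<in>players N. strategy N M b (S b)) \<longrightarrow> S a = S\<^sub>a \<longrightarrow>
          limit_distribution_exists N M S n \<longrightarrow> C (limit_distribution N M S n))"

text \<open>The exponential on \<open>\<real> \<union> {-\<infinity>}\<close>; the value at \<open>\<infinity>\<close> is irrelevant.\<close>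

definition exp_ereal :: "ereal \<Rightarrow> real" where
  "exp_ereal x = (if x = -\<infinity> then 0 else exp (real_of_ereal x))"

end

theory Submission
  imports Defs
begin

text \<open>
  The mechanism is a conservation law for long-run averages, independent of the bias \<open>K\<close>: whatever
  the opponents do, each component \<open>x\<close> of the Press--Dyson tensor of a memory-\<open>n\<close> strategy of
  player \<open>a\<close> has mean zero under the limit distribution. Indeed, after round \<open>t \<ge> n\<close> the mean of
  that component under the marginal distribution of the last \<open>n\<close> profiles is the probability that
  \<open>a\<close> plays \<open>x\<close> in round \<open>t + 1\<close> minus the probability that \<open>a\<close> plays \<open>x\<close> in round \<open>t\<close>. Summed over
  time this telescopes to a number in \<open>[-1, 1]\<close>, which the factor \<open>1 / \<tau>\<close> of the time average
  sends to \<open>0\<close> (lemma \<open>expect_press_dyson_eq_0\<close>).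

  For the tensor of the theorem, the combination \<open>\<Sum>x. c x * press_dyson a T\<^sub>a x w\<close> is, by the
  zero-determinant relation, the payoff combination \<open>\<Sum>b. \<alpha> b * payoff s b (hd w)\<close> times the weight
  \<open>exp (K w - K_max)\<close>. The conservation law therefore makes the mean of the payoff combination,
  weighted with \<open>exp (K w)\<close>, vanish: the positive constant \<open>exp K_max\<close> factors out. Dividing by
  the mean weight gives the biased linear relation, unless that mean weight is zero; as
  probabilities and weights are nonnegative, the limit distribution then vanishes wherever the
  weight does not.
\<close>

section \<open>Words of profiles\<close>

lemma finite_profiles: "finite (profiles N M)"
  unfolding profiles_def players_def actions_def by (intro finite_PiE) auto

lemma finite_words: "finite (words N M n)"
  unfolding words_def using finite_lists_length_eq[OF finite_profiles] .

lemma words_0: "words N M 0 = {[]}"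
  unfolding words_def by auto

lemma sum_words_add:
  "(\<Sum>h\<in>words N M (n + m). f h) = (\<Sum>w\<in>words N M n. \<Sum>u\<in>words N M m. f (w @ u))"
proof -
  have "(\<Sum>h\<in>words N M (n + m). f h)
      = (\<Sum>(w, u)\<in>words N M n \<times> words N M m. f (w @ u))"
    by (rule sum.reindex_bij_witness[where i="\<lambda>(w, u). w @ u" and j="\<lambda>h. (take n h, drop n h)"])
       (auto simp: words_def dest: in_set_takeD in_set_dropD)
  then show ?thesis
    by (simp add: sum.cartesian_product)
qed

lemma sum_words_Suc:
  "(\<Sum>h\<in>words N M (Suc t). f h) = (\<Sum>h\<in>words N M t. \<Sum>\<sigma>\<in>profiles N M. f (\<sigma> # h))"
proof -
  have "(\<Sum>h\<in>words N M (Suc t). f h) = (\<Sum>(h, \<sigma>)\<in>words N M t \<times> profiles N M. f (\<sigma> # h))"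
    by (rule sum.reindex_bij_witness[where i="\<lambda>(h, \<sigma>). \<sigma> # h" and j="\<lambda>h. (tl h, hd h)"])
       (auto simp: words_def length_Suc_conv)
  then show ?thesis
    by (simp add: sum.cartesian_product)
qed

section \<open>The law of the game\<close>

definition move_prob :: "nat \<Rightarrow> (nat \<Rightarrow> behavior) \<Rightarrow> history \<Rightarrow> profile \<Rightarrow> real" where
  "move_prob N S h \<sigma> = (\<Prod>b\<in>players N. pmf (S b h) (\<sigma> b))"

definition action_prob ::
    "nat \<Rightarrow> (nat \<Rightarrow> nat) \<Rightarrow> (nat \<Rightarrow> behavior) \<Rightarrow> nat \<Rightarrow> nat \<Rightarrow> nat \<Rightarrow> real" where
  "action_prob N M S a x t =
     (\<Sum>h\<in>words N M t. joint_prob N S t h * (if x = hd h a then 1 else 0))"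

lemma joint_prob_0: "joint_prob N S 0 h = 1"
  by (simp add: joint_prob_def)

lemma joint_prob_Cons: "joint_prob N S (Suc t) (\<sigma> # h) = joint_prob N S t h * move_prob N S h \<sigma>"
proof -
  have "(\<Prod>t'=1..t. \<Prod>b\<in>players N.
            pmf (S b (drop (Suc t - t' + 1) (\<sigma> # h))) (((\<sigma> # h) ! (Suc t - t')) b))
      = (\<Prod>t'=1..t. \<Prod>b\<in>players N. pmf (S b (drop (t - t' + 1) h)) ((h ! (t - t')) b))"
    by (intro prod.cong refl) (simp add: Suc_diff_le)
  then show ?thesis
    unfolding joint_prob_def move_prob_def by simp
qed

lemma joint_prob_nonneg: "joint_prob N S t h \<ge> 0"
  unfolding joint_prob_def by (intro prod_nonneg ballI) auto

lemma marginal_prob_nonneg: "marginal_prob N M S n t w \<ge> 0"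
  unfolding marginal_prob_def by (intro sum_nonneg joint_prob_nonneg)

lemma sum_marginal_prob:
  assumes "n \<le> t"
  shows "(\<Sum>w\<in>words N M n. marginal_prob N M S n t w * g w)
       = (\<Sum>h\<in>words N M t. joint_prob N S t h * g (take n h))"
proof -
  have "(\<Sum>h\<in>words N M t. joint_prob N S t h * g (take n h))
      = (\<Sum>w\<in>words N M n. \<Sum>u\<in>words N M (t - n). joint_prob N S t (w @ u) * g (take n (w @ u)))"
    using assms sum_words_add[of "\<lambda>h. joint_prob N S t h * g (take n h)" N M n "t - n"] by simp
  also have "\<dots> = (\<Sum>w\<in>words N M n. marginal_prob N M S n t w * g w)"
    unfolding marginal_prob_def sum_distrib_right
    by (intro sum.cong refl) (auto simp: words_def)
  finally show ?thesis ..
qed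

context
  fixes N :: nat and M :: "nat \<Rightarrow> nat" and S :: "nat \<Rightarrow> behavior"
  assumes strategies: "\<And>b. b \<in> players N \<Longrightarrow> strategy N M b (S b)"
begin

lemma sum_pmf_actions:
  assumes "b \<in> players N" "h \<in> words N M t"
  shows "(\<Sum>y\<in>actions M b. pmf (S b h) y) = 1"
  using strategies[OF assms(1)] assms(2)
  by (intro sum_pmf_eq_1) (auto simp: strategy_def actions_def)

lemma sum_move_prob:
  assumes "h \<in> words N M t"
  shows "(\<Sum>\<sigma>\<in>profiles N M. move_prob N S h \<sigma>) = 1"
proof -
  have "(\<Sum>\<sigma>\<in>profiles N M. move_prob N S h \<sigma>)
      = (\<Prod>b\<in>players N. \<Sum>y\<in>actions M b. pmf (S b h) y)"
    unfolding move_prob_def profiles_def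
    by (rule prod_sum_PiE[symmetric]) (auto simp: players_def actions_def)
  also have "\<dots> = 1"
    using sum_pmf_actions assms by (intro prod.neutral) auto
  finally show ?thesis .
qed

text \<open>Given the history, the players choose independently, so the other players' choices sum out.\<close>

lemma sum_move_prob_action:
  assumes a: "a \<in> players N" and x: "x \<in> actions M a" and h: "h \<in> words N M t"
  shows "(\<Sum>\<sigma>\<in>profiles N M. move_prob N S h \<sigma> * (if x = \<sigma> a then 1 else 0)) = pmf (S a h) x"
proof -
  have fin: "finite (players N)" "finite (actions M b)" for b
    by (auto simp: players_def actions_def)
  (* The indicator is absorbed into the factor of player a, so that the sum of products factors. *)
  define f where "f b y = pmf (S b h) y * (if b = a then if x = y then 1 else 0 else 1)" for b y
  have "move_prob N S h \<sigma> * (if x = \<sigma> a then 1 else 0) = (\<Prod>b\<in>players N. f b (\<sigma> b))" for \<sigma>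
    unfolding move_prob_def f_def prod.distrib using a fin by (simp add: prod.delta)
  then have "(\<Sum>\<sigma>\<in>profiles N M. move_prob N S h \<sigma> * (if x = \<sigma> a then 1 else 0))
      = (\<Prod>b\<in>players N. \<Sum>y\<in>actions M b. f b y)"
    unfolding profiles_def using fin by (simp add: prod_sum_PiE)
  also have "\<dots> = (\<Prod>b\<in>players N. if b = a then pmf (S a h) x else 1)"
  proof (intro prod.cong refl)
    fix b assume "b \<in> players N"
    then show "(\<Sum>y\<in>actions M b. f b y) = (if b = a then pmf (S a h) x else 1)"
      using sum_pmf_actions[OF _ h] x fin
      by (cases "b = a") (simp_all add: f_def mult_delta_right sum.delta)
  qed
  also have "\<dots> = pmf (S a h) x"
    using a fin by (simp add: prod.delta)
  finally show ?thesis .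
qed

lemma sum_joint_prob: "(\<Sum>h\<in>words N M t. joint_prob N S t h) = 1"
proof (induction t)
  case 0
  then show ?case by (simp add: words_0 joint_prob_0)
next
  case (Suc t)
  have "(\<Sum>h\<in>words N M (Suc t). joint_prob N S (Suc t) h)
      = (\<Sum>h\<in>words N M t. joint_prob N S t h * (\<Sum>\<sigma>\<in>profiles N M. move_prob N S h \<sigma>))"
    by (simp add: sum_words_Suc joint_prob_Cons sum_distrib_left)
  with Suc show ?case by (simp add: sum_move_prob)
qed

lemma action_prob_bounds: "0 \<le> action_prob N M S a x t" "action_prob N M S a x t \<le> 1"
proof -
  show "0 \<le> action_prob N M S a x t"
    unfolding action_prob_def by (intro sum_nonneg) (simp add: joint_prob_nonneg)
  have "action_prob N M S a x t \<le> (\<Sum>h\<in>words N M t. joint_prob N S t h)"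
    unfolding action_prob_def by (intro sum_mono) (simp add: joint_prob_nonneg)
  then show "action_prob N M S a x t \<le> 1"
    by (simp add: sum_joint_prob)
qed

lemma action_prob_Suc:
  assumes "a \<in> players N" "x \<in> actions M a"
  shows "action_prob N M S a x (Suc t) = (\<Sum>h\<in>words N M t. joint_prob N S t h * pmf (S a h) x)"
proof -
  have "action_prob N M S a x (Suc t) = (\<Sum>h\<in>words N M t. joint_prob N S t h *
          (\<Sum>\<sigma>\<in>profiles N M. move_prob N S h \<sigma> * (if x = \<sigma> a then 1 else 0)))"
    unfolding action_prob_def sum_words_Suc joint_prob_Cons sum_distrib_left
    by (simp add: mult.assoc)
  then show ?thesis
    by (simp add: sum_move_prob_action[OF assms])
qed

section \<open>The Press--Dyson tensor has mean zero\<close>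

text \<open>From round \<open>n + 1\<close> on, the tensor is the conditional probability of the next action minus
  the indicator of the last one.\<close>

lemma sum_marginal_prob_press_dyson:
  assumes a: "a \<in> players N" and x: "x \<in> actions M a" and n: "n \<ge> 1" "n \<le> t"
    and T: "memory_strategy N M a n (S a) T"
  shows "(\<Sum>w\<in>words N M n. marginal_prob N M S n t w * press_dyson a T x w)
       = action_prob N M S a x (Suc t) - action_prob N M S a x t"
proof -
  have "joint_prob N S t h * press_dyson a T x (take n h)
      = joint_prob N S t h * pmf (S a h) x - joint_prob N S t h * (if x = hd h a then 1 else 0)"
    if h: "h \<in> words N M t" for h
  proof -
    have "h \<in> words N M (Suc t - 1)" "Suc t > n"
      using h n by simp_all
    then have "S a h = T (take n h)"
      using T unfolding memory_strategy_def by blast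
    moreover have "hd (take n h) = hd h"
      using n by (simp add: hd_take)
    ultimately show ?thesis
      by (simp add: press_dyson_def right_diff_distrib)
  qed
  then have "(\<Sum>h\<in>words N M t. joint_prob N S t h * press_dyson a T x (take n h))
      = action_prob N M S a x (Suc t) - action_prob N M S a x t"
    by (simp add: action_prob_Suc[OF a x] action_prob_def[of N M S a x t] flip: sum_subtractf)
  then show ?thesis
    by (simp add: sum_marginal_prob[OF n(2)])
qed

lemma sum_time_average_press_dyson:
  assumes "a \<in> players N" "x \<in> actions M a" "n \<ge> 1" "memory_strategy N M a n (S a) T"
  shows "(\<Sum>w\<in>words N M n. time_average N M S n w \<tau> * press_dyson a T x w)
       = (action_prob N M S a x (\<tau> + n) - action_prob N M S a x n) / real \<tau>"
proof -
  have "(\<Sum>w\<in>words N M n. time_average N M S n w \<tau> * press_dyson a T x w)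
      = (\<Sum>w\<in>words N M n. \<Sum>t=n..\<tau> + n - 1.
           1 / real \<tau> * (marginal_prob N M S n t w * press_dyson a T x w))"
    by (simp add: time_average_def sum_distrib_left sum_distrib_right mult.assoc)
  also have "\<dots> = (\<Sum>t=n..\<tau> + n - 1.
           1 / real \<tau> * (\<Sum>w\<in>words N M n. marginal_prob N M S n t w * press_dyson a T x w))"
    unfolding sum_distrib_left by (rule sum.swap)
  also have "\<dots> = 1 / real \<tau> *
      (\<Sum>t=n..\<tau> + n - 1. action_prob N M S a x (Suc t) - action_prob N M S a x t)"
    unfolding sum_distrib_left[of "1 / real \<tau>" _ "{n..\<tau> + n - 1}"]
    by (intro sum.cong refl) (simp add: sum_marginal_prob_press_dyson[OF assms(1-3) _ assms(4)])
  also have "(\<Sum>t=n..\<tau> + n - 1. action_prob N M S a x (Suc t) - action_prob N M S a x t)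
      = action_prob N M S a x (\<tau> + n) - action_prob N M S a x n"
    using assms(3) by (subst sum_Suc_diff) auto
  finally show ?thesis by simp
qed

lemma time_average_tendsto:
  assumes "limit_distribution_exists N M S n" "w \<in> words N M n"
  shows "time_average N M S n w \<longlonglongrightarrow> limit_distribution N M S n w"
  using assms unfolding limit_distribution_exists_def limit_distribution_def
  by (simp add: convergent_LIMSEQ_iff)

lemma limit_distribution_nonneg:
  assumes "limit_distribution_exists N M S n" "w \<in> words N M n"
  shows "limit_distribution N M S n w \<ge> 0"
  by (rule LIMSEQ_le_const[OF time_average_tendsto[OF assms]])
     (auto simp: time_average_def intro!: sum_nonneg divide_nonneg_nonneg marginal_prob_nonneg)

text \<open>The mean over the first rounds is a telescoping sum divided by the number of rounds, and the
  sum stays in \<open>[-1, 1]\<close>.\<close>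

lemma expect_press_dyson_eq_0:
  assumes "a \<in> players N" "x \<in> actions M a" "n \<ge> 1" "memory_strategy N M a n (S a) T"
    and ex: "limit_distribution_exists N M S n"
  shows "expect N M n (limit_distribution N M S n) (press_dyson a T x) = 0"
proof (rule LIMSEQ_unique)
  show "(\<lambda>\<tau>. \<Sum>w\<in>words N M n. press_dyson a T x w * time_average N M S n w \<tau>)
      \<longlonglongrightarrow> expect N M n (limit_distribution N M S n) (press_dyson a T x)"
    unfolding expect_def by (intro tendsto_intros time_average_tendsto ex)
  have "\<bar>(action_prob N M S a x (\<tau> + n) - action_prob N M S a x n) / real \<tau>\<bar> \<le> 1 / real \<tau>" for \<tau>
    using action_prob_bounds[of a x "\<tau> + n"] action_prob_bounds[of a x n]
    by (simp only: abs_divide abs_of_nat) (intro divide_right_mono, auto)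
  then have "(\<lambda>\<tau>. (action_prob N M S a x (\<tau> + n) - action_prob N M S a x n) / real \<tau>) \<longlonglongrightarrow> 0"
    by (intro Lim_null_comparison[OF _ lim_1_over_n] always_eventually) auto
  then show "(\<lambda>\<tau>. \<Sum>w\<in>words N M n. press_dyson a T x w * time_average N M S n w \<tau>) \<longlonglongrightarrow> 0"
    by (simp add: sum_time_average_press_dyson[OF assms(1-4), symmetric] mult.commute)
qed

end

section \<open>Biasing the zero-determinant strategy\<close>

lemma exp_ereal_nonneg: "exp_ereal x \<ge> 0"
  by (simp add: exp_ereal_def)

lemma exp_ereal_diff:
  assumes "x < \<infinity>" "\<bar>y\<bar> \<noteq> \<infinity>"
  shows "exp_ereal x = exp_ereal y * exp_ereal (x - y)"
  using assms by (cases x; cases y) (auto simp: exp_ereal_def simp flip: exp_add)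

text \<open>The weighted payoff combination is, pointwise, a combination of components of the
  Press--Dyson tensor, each of which has mean zero; the hypothesis on \<open>P\<close> is that conservation
  law.\<close>

lemma expect_biased_payoffs_eq_0:
  fixes K :: "history \<Rightarrow> ereal" and \<kappa> :: ereal
  assumes "n \<ge> 1"
    and ZD: "\<And>\<sigma>. \<sigma> \<in> profiles N M \<Longrightarrow>
      (\<Sum>x\<in>actions M a. c x * press_dyson a T1 x [\<sigma>]) = (\<Sum>b=0..N. \<alpha> b * payoff s b \<sigma>)"
    and K: "\<And>w. w \<in> words N M n \<Longrightarrow> K w < \<infinity>" and \<kappa>: "\<bar>\<kappa>\<bar> \<noteq> \<infinity>"
    and T: "\<And>x w. x \<in> actions M a \<Longrightarrow> w \<in> words N M n \<Longrightarrow>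
      press_dyson a T x w = press_dyson a T1 x [hd w] * exp_ereal (K w - \<kappa>)"
    and P: "\<And>x. x \<in> actions M a \<Longrightarrow> expect N M n P (press_dyson a T x) = 0"
  shows "(\<Sum>b=0..N. \<alpha> b * expect N M n P (\<lambda>w. payoff s b (hd w) * exp_ereal (K w))) = 0"
proof -
  have pointwise: "(\<Sum>b=0..N. \<alpha> b * payoff s b (hd w)) * exp_ereal (K w)
      = exp_ereal \<kappa> * (\<Sum>x\<in>actions M a. c x * press_dyson a T x w)"
    if w: "w \<in> words N M n" for w
  proof -
    have "hd w \<in> profiles N M"
      using w \<open>n \<ge> 1\<close> by (cases w) (auto simp: words_def)
    from ZD[OF this, symmetric] show ?thesis
      using exp_ereal_diff[OF K[OF w] \<kappa>]
      by (simp add: T[OF _ w] sum_distrib_left sum_distrib_right mult_ac)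
  qed
  have "(\<Sum>b=0..N. \<alpha> b * expect N M n P (\<lambda>w. payoff s b (hd w) * exp_ereal (K w)))
      = (\<Sum>w\<in>words N M n. (\<Sum>b=0..N. \<alpha> b * payoff s b (hd w)) * exp_ereal (K w) * P w)"
    unfolding expect_def sum_distrib_left sum_distrib_right
    by (subst sum.swap) (simp add: mult_ac)
  also have "\<dots> = (\<Sum>w\<in>words N M n. \<Sum>x\<in>actions M a.
      exp_ereal \<kappa> * (c x * (press_dyson a T x w * P w)))"
    by (intro sum.cong refl) (simp only: pointwise, simp add: sum_distrib_left sum_distrib_right mult_ac)
  also have "\<dots> = (\<Sum>x\<in>actions M a. exp_ereal \<kappa> * (c x * expect N M n P (press_dyson a T x)))"
    unfolding expect_def sum_distrib_left by (rule sum.swap)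
  also have "\<dots> = 0"
    by (simp add: P)
  finally show ?thesis .
qed

theorem theorem1:
  fixes N n a :: nat and M :: "nat \<Rightarrow> nat"
    and s :: "nat \<Rightarrow> profile \<Rightarrow> real"
    and c \<alpha> :: "nat \<Rightarrow> real"
    and S1 S\<^sub>a :: behavior
    and T1 T\<^sub>a :: "history \<Rightarrow> nat pmf"
    and K :: "history \<Rightarrow> ereal" and K_max :: ereal
  assumes "\<forall>b\<in>players N. M b \<ge> 1"
    and "a \<in> players N"
    and "n \<ge> 1"
    and "memory_one_ZD_strategy N M s a c \<alpha> S1 T1"
    and "\<forall>w\<in>words N M n. K w < \<infinity>"
    and "\<exists>w\<in>words N M n. K w \<noteq> -\<infinity>"
    and "K_max = Max (K ` words N M n)"
    and "memory_strategy N M a n S\<^sub>a T\<^sub>a"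
    and "\<forall>x\<in>actions M a. \<forall>w\<in>words N M n.
           press_dyson a T\<^sub>a x w = press_dyson a T1 x [hd w] * exp_ereal (K w - K_max)"
  shows "unilaterally_enforces N M n a S\<^sub>a (\<lambda>P.
      (expect N M n P (\<lambda>w. exp_ereal (K w)) \<noteq> 0 \<and>
       0 = (\<Sum>b=0..N. \<alpha> b *
             (expect N M n P (\<lambda>w. payoff s b (hd w) * exp_ereal (K w)) /
              expect N M n P (\<lambda>w. exp_ereal (K w))))) \<or>
      (\<forall>w\<in>{w \<in> words N M n. exp_ereal (K w) \<noteq> 0}. 0 = P w))"
  unfolding unilaterally_enforces_def
proof (intro allI impI)
  fix S :: "nat \<Rightarrow> behavior"
  assume "\<forall>b\<in>players N. strategy N M b (S b)" and Sa: "S a = S\<^sub>a"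
    and ex: "limit_distribution_exists N M S n"
  then have S: "\<And>b. b \<in> players N \<Longrightarrow> strategy N M b (S b)" by blast
  let ?P = "limit_distribution N M S n"
  let ?Z = "expect N M n ?P (\<lambda>w. exp_ereal (K w))"
  (* The maximum is attained, and it dominates a value above -\<infinity>; so it is a real number. *)
  have "K_max \<in> K ` words N M n"
    using assms(6,7) finite_words by (auto intro!: Max_in)
  moreover have "K_max \<noteq> -\<infinity>"
  proof -
    obtain w where "w \<in> words N M n" "K w \<noteq> -\<infinity>"
      using assms(6) by blast
    moreover from this have "K w \<le> K_max"
      using assms(7) finite_words by (auto intro!: Max_ge)
    ultimately show ?thesis by auto
  qed
  ultimately have K_max: "\<bar>K_max\<bar> \<noteq> \<infinity>"
    using assms(5) by auto
  have "expect N M n ?P (press_dyson a T\<^sub>a x) = 0" if "x \<in> actions M a" for x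
    using expect_press_dyson_eq_0[OF S assms(2) that assms(3) _ ex] assms(8) Sa by simp
  then have relation:
    "(\<Sum>b=0..N. \<alpha> b * expect N M n ?P (\<lambda>w. payoff s b (hd w) * exp_ereal (K w))) = 0"
    using assms(4,5,9) unfolding memory_one_ZD_strategy_def
    by (intro expect_biased_payoffs_eq_0[where T=T\<^sub>a and ?T1.0=T1 and a=a and c=c and \<kappa>=K_max]
          assms(3) K_max) auto
  show "(?Z \<noteq> 0 \<and>
      0 = (\<Sum>b=0..N. \<alpha> b * (expect N M n ?P (\<lambda>w. payoff s b (hd w) * exp_ereal (K w)) / ?Z))) \<or>
      (\<forall>w\<in>{w \<in> words N M n. exp_ereal (K w) \<noteq> 0}. 0 = ?P w)"
  proof (cases "?Z = 0")
    case False
    then show ?thesis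
      using relation by (simp flip: sum_divide_distrib)
  next
    case True
    then have "\<forall>w\<in>words N M n. exp_ereal (K w) * ?P w = 0"
      unfolding expect_def
      by (subst (asm) sum_nonneg_eq_0_iff)
         (auto simp: finite_words intro!: mult_nonneg_nonneg exp_ereal_nonneg
            limit_distribution_nonneg[OF _ ex] S)
    then show ?thesis by auto
  qed
qed

end
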